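(* Let $Y$ be a locally compact, separable metric space and $q:Y\to X$ a continuous surjective map with $X$ Hausdorff. Then the following are equivalent: (i) $q$ is irreducible; (ii) for every non-empty open $U\subseteq Y$ and $n\in \mathbf{N}$, there is a compact fibre $F$ of $q$ contained in $U$ with the diameter of $F$ less than $1/n$; (iii) the set of singleton fibres is dense in $Y$ (and indeed contains a dense $G_{\delta}$ subset of $Y$).
   Context: A surjective map $q:Y\to X$ is irreducible if $Y$ has no proper closed subset $W$ with $q(W)=X$. The fibres of $q$ are the sets $q^{-1}(x)$, $x\in X$. The set of singleton fibres, regarded as a subset of $Y$, is $\{y\in Y: q^{-1}(q(y))=\{y\}\}$. Diameters are taken with respect to the metric of $Y$, and $\mathbf{N}=\{1,2,\dots\}$. *)

theory Defs
  imports "HOL-Analysis.Analysis"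
begin

definition irreducible_map :: "'a topology \<Rightarrow> 'b topology \<Rightarrow> ('a \<Rightarrow> 'b) \<Rightarrow> bool" where
  "irreducible_map Y X q \<longleftrightarrow>
     q ` topspace Y = topspace X \<and>
     \<not> (\<exists>W. closedin Y W \<and> W \<subset> topspace Y \<and> q ` W = topspace X)"

definition fibre :: "'a set \<Rightarrow> ('a \<Rightarrow> 'b) \<Rightarrow> 'b \<Rightarrow> 'a set" where
  "fibre Y q x = {y \<in> Y. q y = x}"

(* The union of the singleton fibres, as a subset of Y. *)
definition singleton_fibres :: "'a set \<Rightarrow> ('a \<Rightarrow> 'b) \<Rightarrow> 'a set" where
  "singleton_fibres Y q = {y \<in> Y. fibre Y q (q y) = {y}}"

end

theory Submission
  imports Defs
begin

text \<open>
  The two elementary implications are (iii) to (ii) and (ii) to (i): a dense set of singleton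
  fibres meets every non-empty open \<open>U\<close>, and a singleton is a compact fibre of diameter zero;
  and if every non-empty open set contains a whole fibre, then a proper closed subset \<open>W\<close> of \<open>Y\<close>
  cannot map onto \<open>X\<close>, because it misses the fibre inside its complement.

  The content is that irreducibility makes the singleton fibres a dense \<open>G\<^sub>\<delta>\<close>.
  Choose a countable family of compact sets in \<open>Y\<close> which separates points
  (\<open>countable_compacts_separating_points\<close>). A point \<open>y\<close> lies on a fibre with a second point exactly
  when, for some disjoint members \<open>K\<close> and \<open>L\<close> of the family, \<open>y\<close> lies in \<open>K\<close> and its fibre meets
  \<open>L\<close>. For fixed \<open>K\<close> and \<open>L\<close> such points form a closed set, since \<open>q ` L\<close> is compact in the
  Hausdorff space \<open>X\<close>, so the singleton fibres always form a \<open>G\<^sub>\<delta>\<close>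
  (\<open>gdelta_in_singleton_fibres\<close>). If this closed set contained a non-empty open \<open>V\<close>, then
  every fibre which meets \<open>V\<close> would also meet \<open>L\<close>, which is disjoint from \<open>V\<close>; deleting \<open>V\<close>
  from \<open>Y\<close> would leave the image unchanged, against irreducibility
  (\<open>irreducible_map_overlap_nowhere_dense\<close>). The Baire category theorem for locally compact
  spaces now gives density.
\<close>

text \<open>
  Closed balls with centres in a countable dense set and radii \<open>1 / (n + 1)\<close> are used, keeping only
  those whose trace on \<open>Y\<close> is compact. By local compactness, all of them that lie close enough to a
  given point are kept, so arbitrarily small members of the family contain that point.
\<close>

lemma countable_compacts_separating_points:
  fixes Y :: "'a::metric_space set"
  assumes lc: "locally_compact_space (top_of_set Y)"
    and sep: "separable_space (top_of_set Y)"
  obtains \<K> where "countable \<K>" "\<And>K. K \<in> \<K> \<Longrightarrow> compactin (top_of_set Y) K"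
    "\<And>y z. \<lbrakk>y \<in> Y; z \<in> Y; y \<noteq> z\<rbrakk> \<Longrightarrow> \<exists>K\<in>\<K>. \<exists>L\<in>\<K>. y \<in> K \<and> z \<in> L \<and> K \<inter> L = {}"
proof -
  obtain D where D: "countable D" "D \<subseteq> Y" "top_of_set Y closure_of D = Y"
    using sep by (auto simp: separable_space_def)
  define B where "B = (\<lambda>(d, n::nat). Y \<inter> cball d (1 / real (Suc n)))"
  define \<K> where "\<K> = {K \<in> B ` (D \<times> UNIV). compact K}"
  have small: "\<exists>K\<in>\<K>. y \<in> K \<and> K \<subseteq> ball y e" if y: "y \<in> Y" and "e > 0" for y e
  proof -
    obtain U C where U: "openin (top_of_set Y) U" and C: "compactin (top_of_set Y) C"
      and "y \<in> U" "U \<subseteq> C"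
      using lc y unfolding locally_compact_space_def by (metis topspace_euclidean_subtopology)
    obtain r where "r > 0" and r: "Y \<inter> ball y r \<subseteq> U"
      using U \<open>y \<in> U\<close> unfolding openin_contains_ball by (metis Int_commute)
    have compC: "compact C" "C \<subseteq> Y"
      using C by (auto simp: compactin_subtopology)
    obtain n where n: "1 / real (Suc n) < min e r / 2"
      using \<open>e > 0\<close> \<open>r > 0\<close> nat_approx_posE[of "min e r / 2"] by auto
    have "y \<in> top_of_set Y closure_of D"
      using D y by simp
    moreover have "openin (top_of_set Y) (Y \<inter> ball y (1 / real (Suc n)))"
      by (simp add: openin_open_Int)
    moreover have "y \<in> Y \<inter> ball y (1 / real (Suc n))"
      using y by simp
    ultimately have "\<exists>d\<in>D. d \<in> Y \<inter> ball y (1 / real (Suc n))"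
      unfolding in_closure_of by blast
    then obtain d where d: "d \<in> D" "dist y d < 1 / real (Suc n)"
      by (auto simp del: of_nat_Suc)
    \<comment> \<open>The radius was halved above because the ball is centred at \<open>d\<close> rather than at \<open>y\<close>.\<close>
    have inb: "cball d (1 / real (Suc n)) \<subseteq> ball y (min e r)"
    proof
      fix x assume "x \<in> cball d (1 / real (Suc n))"
      then have "dist y x < 1 / real (Suc n) + 1 / real (Suc n)"
        using d dist_triangle[of y x d] by (simp del: of_nat_Suc)
      then show "x \<in> ball y (min e r)" using n by simp
    qed
    \<comment> \<open>\<open>Y\<close> need not be closed in the ambient space, so compactness of the trace comes from \<open>C\<close>.\<close>
    then have "B (d, n) = C \<inter> cball d (1 / real (Suc n))"
      using r \<open>U \<subseteq> C\<close> compC by (fastforce simp: B_def)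
    then have "compact (B (d, n))"
      using compC by (simp add: compact_Int_closed)
    moreover have "y \<in> B (d, n)" "B (d, n) \<subseteq> ball y e"
      using d y inb by (auto simp: B_def dist_commute)
    ultimately show ?thesis
      using d by (auto simp: \<K>_def)
  qed
  show thesis
  proof
    show "countable \<K>"
      using D by (auto simp: \<K>_def)
    show "compactin (top_of_set Y) K" if "K \<in> \<K>" for K
      using that by (auto simp: \<K>_def B_def compactin_subtopology)
    show "\<exists>K\<in>\<K>. \<exists>L\<in>\<K>. y \<in> K \<and> z \<in> L \<and> K \<inter> L = {}"
      if yz: "y \<in> Y" "z \<in> Y" "y \<noteq> z" for y z
    proof -
      have "dist y z / 2 > 0" using yz by simp
      then obtain K L where "K \<in> \<K>" "y \<in> K" "K \<subseteq> ball y (dist y z / 2)"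
        "L \<in> \<K>" "z \<in> L" "L \<subseteq> ball z (dist y z / 2)"
        using small yz by metis
      moreover have "ball y (dist y z / 2) \<inter> ball z (dist y z / 2) = {}"
        by (simp add: disjoint_ballI)
      ultimately show ?thesis by blast
    qed
  qed
qed

definition overlap :: "('a \<Rightarrow> 'b) \<Rightarrow> 'a set \<Rightarrow> 'a set \<Rightarrow> 'a set" where
  "overlap q K L = {y \<in> K. q y \<in> q ` L}"

lemma closedin_overlap:
  assumes "Hausdorff_space Y" "Hausdorff_space X" "continuous_map Y X q"
    and "compactin Y K" "compactin Y L"
  shows "closedin Y (overlap q K L)"
  unfolding overlap_def
proof (rule closedin_continuous_map_preimage_gen)
  show "closedin Y K"
    using assms by (blast intro: compactin_imp_closedin)
  show "closedin X (q ` L)"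
    using assms by (blast intro: compactin_imp_closedin image_compactin)
qed (rule assms(3))

text \<open>
  An open set inside the overlap can be deleted from the domain without losing any value of \<open>q\<close>:
  each of its values is still taken on \<open>L\<close>, which lies outside the deleted set.
\<close>

lemma irreducible_map_overlap_nowhere_dense:
  assumes irr: "irreducible_map Y X q" and L: "L \<subseteq> topspace Y" and "K \<inter> L = {}"
  shows "Y interior_of (overlap q K L) = {}"
  unfolding interior_of_eq_empty
proof (intro allI impI)
  fix V assume V: "openin Y V \<and> V \<subseteq> overlap q K L"
  have "q ` (topspace Y - V) = q ` topspace Y"
  proof (rule antisym)
    show "q ` topspace Y \<subseteq> q ` (topspace Y - V)"
    proof (rule image_subsetI)
      fix y assume y: "y \<in> topspace Y"
      show "q y \<in> q ` (topspace Y - V)"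
      proof (cases "y \<in> V")
        case True
        then obtain z where "z \<in> L" "q y = q z"
          using V by (auto simp: overlap_def)
        moreover have "z \<notin> V"
          using V \<open>z \<in> L\<close> \<open>K \<inter> L = {}\<close> by (auto simp: overlap_def)
        ultimately show ?thesis
          using L by auto
      qed (use y in auto)
    qed
  qed auto
  then have "\<not> topspace Y - V \<subset> topspace Y"
    using irr V unfolding irreducible_map_def by (metis closedin_diff closedin_topspace)
  then show "V = {}"
    using V openin_subset by blast
qed

text \<open>
  Separating points by a family of sets turns the uncountable union over pairs of distinct points
  on a common fibre into a union over pairs of members of the family, which is countable when the
  family is.
\<close>

lemma Diff_singleton_fibres_eq_UN_overlap:
  assumes sub: "\<And>K. K \<in> \<K> \<Longrightarrow> K \<subseteq> Y"
    and sep: "\<And>y z. \<lbrakk>y \<in> Y; z \<in> Y; y \<noteq> z\<rbrakk> \<Longrightarrow> \<exists>K\<in>\<K>. \<exists>L\<in>\<K>. y \<in> K \<and> z \<in> L \<and> K \<inter> L = {}"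
  shows "Y - singleton_fibres Y q = \<Union>{overlap q K L | K L. K \<in> \<K> \<and> L \<in> \<K> \<and> K \<inter> L = {}}"
proof (intro antisym subsetI)
  fix y assume y: "y \<in> Y - singleton_fibres Y q"
  then obtain z where z: "z \<in> Y" "q y = q z" "y \<noteq> z"
    by (force simp: singleton_fibres_def fibre_def)
  then obtain K L where "K \<in> \<K>" "L \<in> \<K>" "y \<in> K" "z \<in> L" "K \<inter> L = {}"
    using sep[of y z] y by blast
  moreover have "y \<in> overlap q K L"
    using z \<open>y \<in> K\<close> \<open>z \<in> L\<close> by (simp add: overlap_def)
  ultimately show "y \<in> \<Union>{overlap q K L | K L. K \<in> \<K> \<and> L \<in> \<K> \<and> K \<inter> L = {}}"
    by blast
next
  fix y assume "y \<in> \<Union>{overlap q K L | K L. K \<in> \<K> \<and> L \<in> \<K> \<and> K \<inter> L = {}}"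
  then obtain K L z where "K \<in> \<K>" "L \<in> \<K>" "K \<inter> L = {}" "y \<in> K" "z \<in> L" "q y = q z"
    by (auto simp: overlap_def)
  moreover have "z \<in> fibre Y q (q y)" "z \<noteq> y" "y \<in> Y"
    using calculation sub by (auto simp: fibre_def)
  ultimately show "y \<in> Y - singleton_fibres Y q"
    by (auto simp: singleton_fibres_def)
qed

lemma countable_overlaps:
  assumes "countable \<K>"
  shows "countable {overlap q K L | K L. K \<in> \<K> \<and> L \<in> \<K> \<and> K \<inter> L = {}}"
proof (rule countable_subset)
  show "{overlap q K L | K L. K \<in> \<K> \<and> L \<in> \<K> \<and> K \<inter> L = {}}
      \<subseteq> (\<lambda>(K, L). overlap q K L) ` (\<K> \<times> \<K>)"
    by auto
qed (use assms in auto)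

lemma gdelta_in_singleton_fibres:
  assumes "Hausdorff_space Y" "Hausdorff_space X" "continuous_map Y X q"
    and \<K>: "countable \<K>" "\<And>K. K \<in> \<K> \<Longrightarrow> compactin Y K"
    and sep: "\<And>y z. \<lbrakk>y \<in> topspace Y; z \<in> topspace Y; y \<noteq> z\<rbrakk>
      \<Longrightarrow> \<exists>K\<in>\<K>. \<exists>L\<in>\<K>. y \<in> K \<and> z \<in> L \<and> K \<inter> L = {}"
  shows "gdelta_in Y (singleton_fibres (topspace Y) q)"
proof -
  have "topspace Y - singleton_fibres (topspace Y) q
      = \<Union>{overlap q K L | K L. K \<in> \<K> \<and> L \<in> \<K> \<and> K \<inter> L = {}}"
    using \<K> sep by (intro Diff_singleton_fibres_eq_UN_overlap) (auto dest: compactin_subset_topspace)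
  moreover have "fsigma_in Y (\<Union>{overlap q K L | K L. K \<in> \<K> \<and> L \<in> \<K> \<and> K \<inter> L = {}})"
    using assms
    by (intro fsigma_in_Union countable_overlaps) (auto intro!: closed_imp_fsigma_in closedin_overlap)
  ultimately show ?thesis
    unfolding gdelta_in_fsigma_in by (auto simp: singleton_fibres_def)
qed

text \<open>
  This is the Baire category step: the complement of the singleton fibres is a countable union of
  closed sets without interior.
\<close>

lemma irreducible_map_imp_dense_singleton_fibres:
  assumes "locally_compact_space Y" "Hausdorff_space Y" "Hausdorff_space X" "continuous_map Y X q"
    and \<K>: "countable \<K>" "\<And>K. K \<in> \<K> \<Longrightarrow> compactin Y K"
    and sep: "\<And>y z. \<lbrakk>y \<in> topspace Y; z \<in> topspace Y; y \<noteq> z\<rbrakk>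
      \<Longrightarrow> \<exists>K\<in>\<K>. \<exists>L\<in>\<K>. y \<in> K \<and> z \<in> L \<and> K \<inter> L = {}"
    and irr: "irreducible_map Y X q"
  shows "Y closure_of (singleton_fibres (topspace Y) q) = topspace Y"
proof -
  have "Y interior_of (\<Union>{overlap q K L | K L. K \<in> \<K> \<and> L \<in> \<K> \<and> K \<inter> L = {}}) = {}"
  proof (rule Baire_category_alt)
    show "completely_metrizable_space Y \<or> locally_compact_space Y \<and> regular_space Y"
      using assms locally_compact_Hausdorff_or_regular by blast
    show "closedin Y T \<and> Y interior_of T = {}"
      if "T \<in> {overlap q K L | K L. K \<in> \<K> \<and> L \<in> \<K> \<and> K \<inter> L = {}}" for T
      using that assms closedin_overlap[of Y X q]
        irreducible_map_overlap_nowhere_dense[OF irr] compactin_subset_topspace[of Y]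
      by auto
  qed (rule countable_overlaps[OF \<K>(1)])
  moreover have "topspace Y - singleton_fibres (topspace Y) q
      = \<Union>{overlap q K L | K L. K \<in> \<K> \<and> L \<in> \<K> \<and> K \<inter> L = {}}"
    using \<K> sep by (intro Diff_singleton_fibres_eq_UN_overlap) (auto dest: compactin_subset_topspace)
  ultimately show ?thesis
    by (simp add: closure_of_eq_topspace)
qed

lemma irreducible_map_if_fibres_in_open_sets:
  assumes "q ` topspace Y = topspace X"
    and small: "\<And>U. \<lbrakk>openin Y U; U \<noteq> {}\<rbrakk> \<Longrightarrow> \<exists>x\<in>topspace X. fibre (topspace Y) q x \<subseteq> U"
  shows "irreducible_map Y X q"
  unfolding irreducible_map_def
proof (intro conjI notI; (elim exE conjE)?)
  fix W assume W: "closedin Y W" "W \<subset> topspace Y" "q ` W = topspace X"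
  then have "openin Y (topspace Y - W)" "topspace Y - W \<noteq> {}"
    by auto
  then obtain x where x: "x \<in> topspace X" "fibre (topspace Y) q x \<subseteq> topspace Y - W"
    using small by blast
  then obtain w where "w \<in> W" "q w = x"
    using W(3) by (metis imageE)
  then show False
    using x W by (auto simp: fibre_def)
qed (rule assms(1))

theorem theorem2p3:
  fixes Y :: "'a::metric_space set" and X :: "'b topology" and q :: "'a \<Rightarrow> 'b"
  assumes "locally_compact_space (top_of_set Y)"
    and "separable_space (top_of_set Y)"
    and "Hausdorff_space X"
    and "continuous_map (top_of_set Y) X q"
    and "q ` Y = topspace X"
  defines "cond_i \<equiv> irreducible_map (top_of_set Y) X q"
    and "cond_ii \<equiv> (\<forall>U. \<forall>n\<ge>1::nat. openin (top_of_set Y) U \<and> U \<noteq> {} \<longrightarrow>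
           (\<exists>x\<in>topspace X. compact (fibre Y q x) \<and> fibre Y q x \<subseteq> U \<and>
              diameter (fibre Y q x) < 1 / real n))"
    and "cond_iii \<equiv> (top_of_set Y) closure_of (singleton_fibres Y q) = Y"
    and "cond_iii' \<equiv> (\<exists>G. gdelta_in (top_of_set Y) G \<and> G \<subseteq> singleton_fibres Y q \<and>
           (top_of_set Y) closure_of G = Y)"
  shows "(cond_i \<longleftrightarrow> cond_ii) \<and> (cond_ii \<longleftrightarrow> cond_iii) \<and> (cond_iii \<longleftrightarrow> cond_iii')"
proof -
  have haus: "Hausdorff_space (top_of_set Y)"
    by (simp add: Hausdorff_space_subtopology)
  have "cond_i \<Longrightarrow> cond_iii'"
  proof -
    assume cond_i
    then have irr: "irreducible_map (top_of_set Y) X q"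
      by (simp add: cond_i_def)
    obtain \<K> where \<K>: "countable \<K>" "\<And>K. K \<in> \<K> \<Longrightarrow> compactin (top_of_set Y) K"
      "\<And>y z. \<lbrakk>y \<in> topspace (top_of_set Y); z \<in> topspace (top_of_set Y); y \<noteq> z\<rbrakk>
        \<Longrightarrow> \<exists>K\<in>\<K>. \<exists>L\<in>\<K>. y \<in> K \<and> z \<in> L \<and> K \<inter> L = {}"
      using countable_compacts_separating_points[OF assms(1,2)]
      by (metis topspace_euclidean_subtopology)
    note singleton_fibres_facts =
      gdelta_in_singleton_fibres[OF haus assms(3,4) \<K>]
      irreducible_map_imp_dense_singleton_fibres[OF assms(1) haus assms(3,4) \<K> irr]
    show cond_iii'
      unfolding cond_iii'_def
      using singleton_fibres_facts by (intro exI[of _ "singleton_fibres Y q"]) simp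
  qed
  moreover have "cond_iii' \<Longrightarrow> cond_iii"
    unfolding cond_iii'_def cond_iii_def
    by (metis closure_of_mono closure_of_subset_topspace subset_antisym
        topspace_euclidean_subtopology)
  moreover have "cond_iii \<Longrightarrow> cond_ii"
    unfolding cond_ii_def
  proof (intro allI impI, elim conjE)
    fix U and n :: nat
    assume cond_iii and n: "1 \<le> n" and U: "openin (top_of_set Y) U" "U \<noteq> {}"
    then have "singleton_fibres Y q \<inter> U \<noteq> {}"
      using dense_intersects_open[of "top_of_set Y" "singleton_fibres Y q"]
      by (simp add: cond_iii_def)
    then obtain y where "y \<in> Y" "y \<in> U" "fibre Y q (q y) = {y}"
      by (auto simp: singleton_fibres_def)
    then show "\<exists>x\<in>topspace X. compact (fibre Y q x) \<and> fibre Y q x \<subseteq> U \<and>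
        diameter (fibre Y q x) < 1 / real n"
      using n assms(5) by (intro bexI[of _ "q y"]) auto
  qed
  moreover have "cond_ii \<Longrightarrow> cond_i"
    unfolding cond_i_def
  proof (rule irreducible_map_if_fibres_in_open_sets)
    fix U assume cond_ii "openin (top_of_set Y) U" "U \<noteq> {}"
    then show "\<exists>x\<in>topspace X. fibre (topspace (top_of_set Y)) q x \<subseteq> U"
      unfolding cond_ii_def topspace_euclidean_subtopology by (meson order_refl)
  qed (simp add: assms(5))
  ultimately show ?thesis
    by blast
qed

end
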